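(* Let $(A,\cdot,[-,-],P)$ be a relative Poisson algebra. Extend the vector space $A$ to the $(\dim A+1)$-dimensional vector space $\tilde A=A\oplus\mathbb Ke$. Define two bilinear operations $\cdot_{\tilde A},[-,-]_{\tilde A}:\tilde A\otimes\tilde A\to\tilde A$ and a linear map $\tilde P:\tilde A\to\tilde A$ by $$x\cdot_{\tilde A}y=x\cdot y,\quad e\cdot_{\tilde A}x=x\cdot_{\tilde A}e=x,\quad e\cdot_{\tilde A}e=e,$$ $$[x,y]_{\tilde A}=[x,y],\quad [e,x]_{\tilde A}=-[x,e]_{\tilde A}=P(x),\quad [e,e]_{\tilde A}=0,$$ $$\tilde P(x)=P(x),\quad \tilde P(e)=0,$$ for all $x,y\in A$. Then $(\tilde A,\cdot_{\tilde A},[-,-]_{\tilde A},\tilde P)$ is a unital relative Poisson algebra. Consequently, there is a corresponding Jacobi algebra $(\tilde A,\cdot_{\tilde A},[-,-]_{\tilde A})$.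
   Context: All vector spaces are finite-dimensional over an algebraically closed field $\mathbb K$ of characteristic zero. A relative Poisson algebra $(A,\cdot,[-,-],P)$ consists of a commutative associative (not necessarily unital) algebra $(A,\cdot)$, a Lie algebra $(A,[-,-])$ on the same space, and a linear map $P:A\to A$ that is a derivation of both $\cdot$ and $[-,-]$, such that $[z,x\cdot y]=[z,x]\cdot y+x\cdot[z,y]+x\cdot y\cdot P(z)$ for all $x,y,z\in A$. It is unital if $(A,\cdot)$ is unital. A Jacobi algebra is a triple $(A,\cdot,[-,-])$ with $(A,\cdot)$ a unital commutative associative algebra with unit $1_A$, $(A,[-,-])$ a Lie algebra, and $[z,x\cdot y]=[z,x]\cdot y+x\cdot[z,y]+x\cdot y\cdot[1_A,z]$ for all $x,y,z\in A$. A unital relative Poisson algebra $(A,\cdot,[-,-],P)$ satisfies $P(x)=[1_A,x]$, and the corresponding Jacobi algebra is $(A,\cdot,[-,-])$. *)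

theory Defs
  imports
    "HOL-Analysis.Product_Vector"
    "HOL-Computational_Algebra.Computational_Algebra"
begin

text \<open>
  Every algebra is carried by a whole type of class \<^class>\<open>ab_group_add\<close> with an explicit
  scalar multiplication by an algebraically closed field of characteristic zero.
\<close>

locale fd_vector_space = vector_space scl
  for scl :: "'k::{alg_closed_field, field_char_0} \<Rightarrow> 'a::ab_group_add \<Rightarrow> 'a" +
  assumes finite_dimensional: "\<exists>B. finite_dimensional_vector_space scl B"

definition bilinear_op ::
    "('k::field \<Rightarrow> 'a::ab_group_add \<Rightarrow> 'a) \<Rightarrow> ('a \<Rightarrow> 'a \<Rightarrow> 'a) \<Rightarrow> bool" where
  "bilinear_op scl f \<longleftrightarrow>
     (\<forall>x. Vector_Spaces.linear scl scl (\<lambda>y. f x y)) \<and>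
     (\<forall>y. Vector_Spaces.linear scl scl (\<lambda>x. f x y))"

definition derivation :: "('a::plus \<Rightarrow> 'a \<Rightarrow> 'a) \<Rightarrow> ('a \<Rightarrow> 'a) \<Rightarrow> bool" where
  "derivation f D \<longleftrightarrow> (\<forall>x y. D (f x y) = f (D x) y + f x (D y))"

locale comm_assoc_algebra = fd_vector_space scl
  for scl :: "'k::{alg_closed_field, field_char_0} \<Rightarrow> 'a::ab_group_add \<Rightarrow> 'a" +
  fixes mul :: "'a \<Rightarrow> 'a \<Rightarrow> 'a"
  assumes mul_bilinear: "bilinear_op scl mul"
    and mul_commute: "mul x y = mul y x"
    and mul_assoc: "mul (mul x y) z = mul x (mul y z)"

locale lie_algebra = fd_vector_space scl
  for scl :: "'k::{alg_closed_field, field_char_0} \<Rightarrow> 'a::ab_group_add \<Rightarrow> 'a" +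
  fixes br :: "'a \<Rightarrow> 'a \<Rightarrow> 'a"
  assumes br_bilinear: "bilinear_op scl br"
    and br_self: "br x x = 0"
    and br_jacobi: "br x (br y z) + br y (br z x) + br z (br x y) = 0"

locale relative_poisson_algebra =
  comm_assoc_algebra scl mul + lie_algebra scl br
  for scl :: "'k::{alg_closed_field, field_char_0} \<Rightarrow> 'a::ab_group_add \<Rightarrow> 'a"
    and mul :: "'a \<Rightarrow> 'a \<Rightarrow> 'a"
    and br :: "'a \<Rightarrow> 'a \<Rightarrow> 'a"
    and P :: "'a \<Rightarrow> 'a" +
  assumes P_linear: "Vector_Spaces.linear scl scl P"
    and P_derivation_mul: "derivation mul P"
    and P_derivation_br: "derivation br P"
    and relative_leibniz: "br z (mul x y) = mul (br z x) y + mul x (br z y) + mul (mul x y) (P z)"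

text \<open>The unit is an explicit parameter of the unital structures; it is unique when it exists.\<close>

locale unital_relative_poisson_algebra =
  relative_poisson_algebra scl mul br P
  for scl :: "'k::{alg_closed_field, field_char_0} \<Rightarrow> 'a::ab_group_add \<Rightarrow> 'a"
    and mul :: "'a \<Rightarrow> 'a \<Rightarrow> 'a"
    and br :: "'a \<Rightarrow> 'a \<Rightarrow> 'a"
    and P :: "'a \<Rightarrow> 'a"
    and unit :: 'a +
  assumes unit_mul: "mul unit x = x"

locale jacobi_algebra =
  comm_assoc_algebra scl mul + lie_algebra scl br
  for scl :: "'k::{alg_closed_field, field_char_0} \<Rightarrow> 'a::ab_group_add \<Rightarrow> 'a"
    and mul :: "'a \<Rightarrow> 'a \<Rightarrow> 'a"
    and br :: "'a \<Rightarrow> 'a \<Rightarrow> 'a"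
    and unit :: 'a +
  assumes unit_mul: "mul unit x = x"
    and jacobi_leibniz:
      "br z (mul x y) = mul (br z x) y + mul x (br z y) + mul (mul x y) (br unit z)"

text \<open>
  The space \<open>A \<oplus> K e\<close> is the product type \<open>'a \<times> 'k\<close>: the element \<open>x\<close> of \<open>A\<close> is
  \<open>(x, 0)\<close> and \<open>e\<close> is \<open>(0, 1)\<close>.
\<close>

definition ext_scale ::
    "('k::field \<Rightarrow> 'a::ab_group_add \<Rightarrow> 'a) \<Rightarrow> 'k \<Rightarrow> 'a \<times> 'k \<Rightarrow> 'a \<times> 'k" where
  "ext_scale scl = module_prod.scale scl (*)"

definition inA :: "'a \<Rightarrow> 'a \<times> 'k::zero" where
  "inA x = (x, 0)"

definition ext_e :: "'a::zero \<times> 'k::one" where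
  "ext_e = (0, 1)"

text \<open>
  The operations on \<open>A \<oplus> K e\<close> are given by (bi)linearity and by their values on \<open>A\<close> and \<open>e\<close>.
\<close>

definition unital_extension ::
    "('k::field \<Rightarrow> 'a::ab_group_add \<Rightarrow> 'a) \<Rightarrow> ('a \<Rightarrow> 'a \<Rightarrow> 'a) \<Rightarrow> ('a \<Rightarrow> 'a \<Rightarrow> 'a) \<Rightarrow> ('a \<Rightarrow> 'a) \<Rightarrow>
     ('a \<times> 'k \<Rightarrow> 'a \<times> 'k \<Rightarrow> 'a \<times> 'k) \<Rightarrow> ('a \<times> 'k \<Rightarrow> 'a \<times> 'k \<Rightarrow> 'a \<times> 'k) \<Rightarrow>
     ('a \<times> 'k \<Rightarrow> 'a \<times> 'k) \<Rightarrow> bool" where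
  "unital_extension scl mul br P mul' br' P' \<longleftrightarrow>
     bilinear_op (ext_scale scl) mul' \<and>
     (\<forall>x y. mul' (inA x) (inA y) = inA (mul x y)) \<and>
     (\<forall>x. mul' ext_e (inA x) = inA x) \<and>
     (\<forall>x. mul' (inA x) ext_e = inA x) \<and>
     mul' ext_e ext_e = ext_e \<and>
     bilinear_op (ext_scale scl) br' \<and>
     (\<forall>x y. br' (inA x) (inA y) = inA (br x y)) \<and>
     (\<forall>x. br' ext_e (inA x) = inA (P x)) \<and>
     (\<forall>x. - br' (inA x) ext_e = inA (P x)) \<and>
     br' ext_e ext_e = 0 \<and>
     Vector_Spaces.linear (ext_scale scl) (ext_scale scl) P' \<and>
     (\<forall>x. P' (inA x) = inA (P x)) \<and>
     P' ext_e = 0"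

end

theory Submission
  imports Defs "HOL-Analysis.Cartesian_Space"
begin

text \<open>
  The values prescribed on \<open>A\<close> and \<open>e\<close> determine (bi)linear maps on \<open>A \<oplus> K e\<close>, because every
  element is \<open>x + a e\<close>. Expanding gives the closed forms
  \<open>(x + a e)(y + b e) = (x y + a y + b x) + a b e\<close>,
  \<open>[x + a e, y + b e] = [x, y] + a P y - b P x\<close> and \<open>x + a e \<mapsto> P x\<close>; lemma
  \<open>unital_extension_iff\<close> records that these are the only solution.

  With them the axioms become identities in \<open>A\<close>. The product is the usual adjunction of a unit.
  The bracket is the semidirect product of the Lie algebra \<open>A\<close> with the line \<open>K e\<close> acting by the
  derivation \<open>P\<close>, so the Jacobi identity for one copy of \<open>e\<close> is exactly the statement that \<open>P\<close>
  derives the bracket. The extended \<open>P\<close> is \<open>[e, -]\<close>, and the relative Leibniz rule with \<open>z = e\<close> is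
  exactly the statement that \<open>P\<close> derives the product, the correction term vanishing since
  \<open>P e = 0\<close>. With \<open>e\<close> as a factor of the product, the correction term \<open>y P z\<close> cancels
  \<open>[z, e] y = - (P z) y\<close>.

  The Jacobi algebra comes from the general fact \<open>P_eq_br_unit\<close>: in a unital relative Poisson algebra
  \<open>P\<close> is bracketing with the unit, so the relative Leibniz rule is the Jacobi one.
\<close>

section \<open>Bilinear operations\<close>

lemma bilinear_op_iff:
  "bilinear_op s f \<longleftrightarrow> vector_space s \<and>
     (\<forall>x y z. f (x + y) z = f x z + f y z) \<and> (\<forall>x y z. f x (y + z) = f x y + f x z) \<and>
     (\<forall>c x y. f (s c x) y = s c (f x y)) \<and> (\<forall>c x y. f x (s c y) = s c (f x y))"
  unfolding bilinear_op_def Vector_Spaces.linear_iff by blast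

lemma linear_diff: "Vector_Spaces.linear s t f \<Longrightarrow> f (x - y) = f x - f y"
  by (rule module_hom.diff[OF module_hom_linearI])

lemma
  assumes "bilinear_op s f"
  shows bilinear_op_diff_left: "f (x - y) z = f x z - f y z"
    and bilinear_op_diff_right: "f x (y - z) = f x y - f x z"
  using assms linear_diff[of s s "\<lambda>x. f x z"] linear_diff[of s s "f x"]
  unfolding bilinear_op_def by blast+

lemma (in lie_algebra) br_antisym: "br x y = - br y x"
proof -
  have "br (x + y) (x + y) = br x x + br y x + (br x y + br y y)"
    using br_bilinear unfolding bilinear_op_iff by simp
  then show ?thesis
    by (simp add: br_self eq_neg_iff_add_eq_0 add.commute)
qed

section \<open>Unital relative Poisson algebras and Jacobi algebras\<close>

context unital_relative_poisson_algebra
begin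

text \<open>
  The relative Leibniz rule for \<open>1 \<cdot> 1\<close> reads \<open>[z, 1] = 2 [z, 1] + P z\<close>, so \<open>P z = - [z, 1]\<close>.
\<close>

lemma P_eq_br_unit: "P z = br unit z"
proof -
  have "br z unit = br z unit + br z unit + P z"
    using relative_leibniz[of z unit unit] by (simp add: unit_mul mul_commute[of "br z unit" unit])
  then have "0 = br z unit + P z"
    by (simp add: add.assoc)
  then show ?thesis
    using br_antisym[of unit z] by (metis minus_unique)
qed

lemma jacobi_algebra: "jacobi_algebra scl mul br unit"
  by unfold_locales (simp_all add: unit_mul relative_leibniz P_eq_br_unit)

end

section \<open>The space obtained by adjoining a line\<close>

lemma ext_scale_Pair [simp]:
  assumes "vector_space scl"
  shows "ext_scale scl c (x, a) = (scl c x, c * a)"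
proof -
  interpret vector_space_prod scl "(*)"
    using assms vector_space_over_itself.vector_space_axioms
    by (simp add: vector_space_prod_def vector_space_pair_def)
  show ?thesis
    by (simp add: ext_scale_def scale_prod)
qed

context fd_vector_space
begin

lemma
  shows fd_vector_space_ext: "fd_vector_space (ext_scale scl)"
    and dim_ext: "vector_space.dim (ext_scale scl) UNIV = dim UNIV + 1"
proof -
  obtain B where "finite_dimensional_vector_space scl B"
    using finite_dimensional by blast
  then interpret finite_dimensional_vector_space_prod scl "(*)" B "{1}"
    using vector_space_over_itself.finite_dimensional_vector_space_axioms
    by (simp add: finite_dimensional_vector_space_prod_def finite_dimensional_vector_space_pair_def
        vector_space_prod_def vector_space_pair_def finite_dimensional_vector_space_def)
  show "fd_vector_space (ext_scale scl)"
    unfolding ext_scale_def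
    by unfold_locales (use p.finite_dimensional_vector_space_axioms in blast)
  show "vector_space.dim (ext_scale scl) UNIV = dim UNIV + 1"
    using dimension_pair
    by (simp add: ext_scale_def p.dimension_def vs1.dimension_def dimension_eq_1)
qed

lemma ext_decompose: "(x, a) = inA x + ext_scale scl a ext_e"
  by (simp add: inA_def ext_e_def vector_space_axioms)

end

section \<open>The extended operations\<close>

definition ext_mul ::
    "('k::field \<Rightarrow> 'a::ab_group_add \<Rightarrow> 'a) \<Rightarrow> ('a \<Rightarrow> 'a \<Rightarrow> 'a) \<Rightarrow> 'a \<times> 'k \<Rightarrow> 'a \<times> 'k \<Rightarrow> 'a \<times> 'k" where
  "ext_mul scl mul = (\<lambda>(x, a) (y, b). (mul x y + scl a y + scl b x, a * b))"

definition ext_br ::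
    "('k::field \<Rightarrow> 'a::ab_group_add \<Rightarrow> 'a) \<Rightarrow> ('a \<Rightarrow> 'a \<Rightarrow> 'a) \<Rightarrow> ('a \<Rightarrow> 'a) \<Rightarrow>
     'a \<times> 'k \<Rightarrow> 'a \<times> 'k \<Rightarrow> 'a \<times> 'k" where
  "ext_br scl br P = (\<lambda>(x, a) (y, b). (br x y + scl a (P y) - scl b (P x), 0))"

definition ext_P :: "('a \<Rightarrow> 'a) \<Rightarrow> 'a \<times> 'k::field \<Rightarrow> 'a \<times> 'k" where
  "ext_P P = (\<lambda>(x, a). (P x, 0))"

lemma
  shows ext_mul_Pair: "ext_mul scl mul (x, a) (y, b) = (mul x y + scl a y + scl b x, a * b)"
    and ext_br_Pair: "ext_br scl br P (x, a) (y, b) = (br x y + scl a (P y) - scl b (P x), 0)"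
    and ext_P_Pair: "ext_P P (x, a) = (P x, 0)"
  by (simp_all add: ext_mul_def ext_br_def ext_P_def)

lemmas ext_Pair = ext_mul_Pair ext_br_Pair ext_P_Pair

context relative_poisson_algebra
begin

lemmas P_lin = P_linear[unfolded Vector_Spaces.linear_iff] linear_diff[OF P_linear]
  module_hom.zero[OF module_hom_linearI[OF P_linear]]

lemmas mul_lin = mul_bilinear[unfolded bilinear_op_iff]
  bilinear_op_diff_left[OF mul_bilinear] bilinear_op_diff_right[OF mul_bilinear]

lemmas br_lin = br_bilinear[unfolded bilinear_op_iff]
  bilinear_op_diff_left[OF br_bilinear] bilinear_op_diff_right[OF br_bilinear]

lemmas lin = P_lin mul_lin br_lin

lemma
  shows mul_zero_left: "mul 0 x = 0" and mul_zero_right: "mul x 0 = 0"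
    and br_zero_left: "br 0 x = 0" and br_zero_right: "br x 0 = 0"
  using mul_lin(2)[of 0 0 x] mul_lin(3)[of x 0 0] br_lin(2)[of 0 0 x] br_lin(3)[of x 0 0]
  by simp_all

lemmas lin_zero = mul_zero_left mul_zero_right br_zero_left br_zero_right

lemmas lin_scale = scale_right_distrib scale_left_distrib scale_right_diff_distrib

lemma vector_space_ext: "vector_space (ext_scale scl)"
  using fd_vector_space_ext by (rule fd_vector_space.axioms)

lemma bilinear_ext_mul: "bilinear_op (ext_scale scl) (ext_mul scl mul)"
  unfolding bilinear_op_iff
  by (simp add: vector_space_ext vector_space_axioms ext_Pair lin lin_scale algebra_simps)

lemma bilinear_ext_br: "bilinear_op (ext_scale scl) (ext_br scl br P)"
  unfolding bilinear_op_iff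
  by (simp add: vector_space_ext vector_space_axioms ext_Pair lin lin_scale algebra_simps)

lemma linear_ext_P: "Vector_Spaces.linear (ext_scale scl) (ext_scale scl) (ext_P P)"
  unfolding Vector_Spaces.linear_iff
  by (simp add: vector_space_ext vector_space_axioms ext_Pair lin lin_scale)

text \<open>
  Expanding \<open>x + a e\<close> by linearity in each argument leaves only prescribed values, which forces
  the closed forms; conversely these are (bi)linear and take the prescribed values.
\<close>

lemma unital_extension_iff:
  "unital_extension scl mul br P mul' br' P' \<longleftrightarrow>
     mul' = ext_mul scl mul \<and> br' = ext_br scl br P \<and> P' = ext_P P"
proof
  assume ext: "unital_extension scl mul br P mul' br' P'"
  note sc = ext_scale_Pair[OF vector_space_axioms]
  have br_e: "br' (inA x) ext_e = inA (- P x)" for x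
    using ext unfolding unital_extension_def by (simp add: inA_def minus_equation_iff[of _ "(_, _)"])
  have m: "mul' (x, a) (y, b) = ext_mul scl mul (x, a) (y, b)" for x a y b
  proof -
    have "mul' (inA x + ext_scale scl a ext_e) (inA y + ext_scale scl b ext_e) =
        inA (mul x y) + ext_scale scl a (inA y)
        + ext_scale scl b (inA x + ext_scale scl a ext_e)"
      using ext unfolding unital_extension_def bilinear_op_iff
      by (simp del: split_paired_All)
    then show ?thesis
      unfolding ext_decompose[symmetric] by (simp add: inA_def ext_e_def sc ext_Pair ac_simps)
  qed
  have b: "br' (x, a) (y, b) = ext_br scl br P (x, a) (y, b)" for x a y b
  proof -
    have "br' (inA x + ext_scale scl a ext_e) (inA y + ext_scale scl b ext_e) =
        inA (br x y) + ext_scale scl a (inA (P y))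
        + ext_scale scl b (inA (- P x) + ext_scale scl a 0)"
      using ext br_e unfolding unital_extension_def bilinear_op_iff
      by (simp del: split_paired_All)
    then show ?thesis
      unfolding ext_decompose[symmetric] by (simp add: inA_def sc ext_Pair zero_prod_def)
  qed
  have p: "P' (x, a) = ext_P P (x, a)" for x a
  proof -
    have "P' (inA x + ext_scale scl a ext_e) = inA (P x) + ext_scale scl a 0"
      using ext unfolding unital_extension_def Vector_Spaces.linear_iff
      by (simp del: split_paired_All)
    then show ?thesis
      unfolding ext_decompose[symmetric] by (simp add: inA_def sc ext_Pair zero_prod_def)
  qed
  show "mul' = ext_mul scl mul \<and> br' = ext_br scl br P \<and> P' = ext_P P"
    using m b p by (auto simp: fun_eq_iff)
next
  assume "mul' = ext_mul scl mul \<and> br' = ext_br scl br P \<and> P' = ext_P P"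
  then show "unital_extension scl mul br P mul' br' P'"
    unfolding unital_extension_def
    using bilinear_ext_mul bilinear_ext_br linear_ext_P
    by (simp add: inA_def ext_e_def ext_Pair lin lin_zero zero_prod_def)
qed

section \<open>The extension is a unital relative Poisson algebra\<close>

lemmas P_deriv = P_derivation_mul[unfolded derivation_def, rule_format]
  P_derivation_br[unfolded derivation_def, rule_format]

text \<open>
  Expanded in the scalars \<open>a, b, c\<close> along \<open>e\<close>: the constant term is the Jacobi identity of \<open>A\<close>,
  the linear terms vanish because \<open>P\<close> derives the bracket, and the quadratic ones, such as
  \<open>a b P (P z)\<close>, cancel in pairs.
\<close>

lemma ext_br_jacobi:
  "ext_br scl br P u (ext_br scl br P v w) + ext_br scl br P v (ext_br scl br P w u)
     + ext_br scl br P w (ext_br scl br P u v) = 0"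
proof -
  obtain x a y b z c where [simp]: "u = (x, a)" "v = (y, b)" "w = (z, c)"
    by (metis surj_pair)
  show ?thesis
    using br_jacobi[of x y z]
    \<comment> \<open>Antisymmetry matches the two halves of each \<open>P [x, y]\<close> with the terms that cancel them.\<close>
    by (simp add: ext_Pair lin lin_scale P_deriv zero_prod_def algebra_simps
        br_antisym[of "P x" y] br_antisym[of "P y" z] br_antisym[of "P z" x])
qed

text \<open>
  When \<open>u\<close> is \<open>e\<close>, the rule holds because the correction term \<open>v P w\<close> cancels
  \<open>[w, e] v = - (P w) v\<close>, and likewise for \<open>v\<close>. When \<open>w\<close> is \<open>e\<close>, it says that \<open>P\<close> derives the product.
\<close>

lemma ext_relative_leibniz:
  "ext_br scl br P w (ext_mul scl mul u v) =
     ext_mul scl mul (ext_br scl br P w u) v + ext_mul scl mul u (ext_br scl br P w v)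
     + ext_mul scl mul (ext_mul scl mul u v) (ext_P P w)"
proof -
  obtain x a y b z c where [simp]: "u = (x, a)" "v = (y, b)" "w = (z, c)"
    by (metis surj_pair)
  show ?thesis
    by (simp add: ext_Pair lin lin_scale P_deriv relative_leibniz algebra_simps
        mul_commute[of "P z" y] mul_commute[of "P z" x])
qed

lemma unital_relative_poisson_algebra_ext:
  "unital_relative_poisson_algebra (ext_scale scl) (ext_mul scl mul) (ext_br scl br P) (ext_P P) ext_e"
proof -
  interpret ext: fd_vector_space "ext_scale scl"
    by (rule fd_vector_space_ext)
  show ?thesis
  proof unfold_locales
    fix u v w :: "'a \<times> 'k"
    obtain x a y b z c where [simp]: "u = (x, a)" "v = (y, b)" "w = (z, c)"
      by (metis surj_pair)
    show "ext_mul scl mul u v = ext_mul scl mul v u"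
      by (simp add: ext_Pair mul_commute[of x y] algebra_simps)
    show "ext_mul scl mul (ext_mul scl mul u v) w = ext_mul scl mul u (ext_mul scl mul v w)"
      by (simp add: ext_Pair lin lin_scale mul_assoc algebra_simps)
    show "ext_br scl br P u u = 0"
      by (simp add: ext_Pair br_self zero_prod_def)
    show "ext_mul scl mul ext_e u = u"
      by (simp add: ext_Pair ext_e_def lin_zero)
  next
    show "derivation (ext_mul scl mul) (ext_P P)"
      by (simp add: derivation_def ext_Pair lin P_deriv algebra_simps)
    show "derivation (ext_br scl br P) (ext_P P)"
      by (simp add: derivation_def ext_Pair lin P_deriv algebra_simps)
  qed (simp_all add: bilinear_ext_mul bilinear_ext_br linear_ext_P[unfolded Vector_Spaces.linear_iff]
      ext_br_jacobi ext_relative_leibniz)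
qed

end

theorem lemma5p5:
  fixes scl :: "'k::{alg_closed_field, field_char_0} \<Rightarrow> 'a::ab_group_add \<Rightarrow> 'a"
    and mul br :: "'a \<Rightarrow> 'a \<Rightarrow> 'a"
    and P :: "'a \<Rightarrow> 'a"
  assumes "relative_poisson_algebra scl mul br P"
  shows "vector_space.dim (ext_scale scl) UNIV = vector_space.dim scl UNIV + 1 \<and>
    (\<exists>!(mul', br', P'). unital_extension scl mul br P mul' br' P') \<and>
    (\<forall>mul' br' P'. unital_extension scl mul br P mul' br' P' \<longrightarrow>
       unital_relative_poisson_algebra (ext_scale scl) mul' br' P' ext_e \<and>
       jacobi_algebra (ext_scale scl) mul' br' ext_e)"
proof -
  interpret relative_poisson_algebra scl mul br P
    by (fact assms)
  show ?thesis
    using dim_ext unital_relative_poisson_algebra_ext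
      unital_relative_poisson_algebra.jacobi_algebra[OF unital_relative_poisson_algebra_ext]
    by (auto simp: unital_extension_iff)
qed

end
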